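(* Let $R$ be a commutative ring with $1$ and let $n$ be a positive integer. Every semiprime submodule of $R^n$ is a radical submodule. More precisely, for every submodule $N$ of $R^n$, its radical $\sqrt{N}$ is the smallest semiprime submodule of $R^n$ that contains $N$.
   Context: A submodule $N$ of $R^n$ is semiprime if for every $\mathbf{f}=(f_1,\ldots,f_n)\in R^n$ such that $f_i\mathbf{f}\in N$ for $i=1,\ldots,n$ we have $\mathbf{f}\in N$. A submodule $N$ of an $R$-module $M$ is prime if for every $r\in R$ and every $\mathbf{m}\in M$ such that $r\mathbf{m}\in N$ we have $\mathbf{m}\in N$ or $rM\subseteq N$. (Prime and semiprime submodules are not required to be proper.) The radical $\sqrt{N}$ of a submodule $N$ of $M$ is the intersection of all prime submodules of $M$ that contain $N$. A submodule $N$ is a radical submodule if $\sqrt{N}=N$. "Smallest" is with respect to inclusion. *)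

theory Defs
  imports "HOL-Algebra.Module"
begin

text \<open>
  The module \<open>R\<^sup>n\<close> consists of the extensional functions from \<open>{1..n}\<close> to \<open>R\<close>.
  The record type of modules extends that of rings, so the ring fields \<open>mult\<close> and \<open>one\<close>
  have to be given a value (here the componentwise one); neither the locale \<open>module\<close>
  nor the locale \<open>submodule\<close> refers to them.
\<close>

definition free_module :: "('a, 'c) ring_scheme \<Rightarrow> nat \<Rightarrow> ('a, nat \<Rightarrow> 'a) module" where
  "free_module R n =
    \<lparr>carrier = {1..n} \<rightarrow>\<^sub>E carrier R,
     monoid.mult = (\<lambda>f g. \<lambda>i\<in>{1..n}. f i \<otimes>\<^bsub>R\<^esub> g i),
     one = (\<lambda>i\<in>{1..n}. \<one>\<^bsub>R\<^esub>),
     zero = (\<lambda>i\<in>{1..n}. \<zero>\<^bsub>R\<^esub>),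
     add = (\<lambda>f g. \<lambda>i\<in>{1..n}. f i \<oplus>\<^bsub>R\<^esub> g i),
     smult = (\<lambda>r f. \<lambda>i\<in>{1..n}. r \<otimes>\<^bsub>R\<^esub> f i)\<rparr>"

definition prime_submodule ::
    "('a, 'c) ring_scheme \<Rightarrow> ('a, 'b, 'd) module_scheme \<Rightarrow> 'b set \<Rightarrow> bool" where
  "prime_submodule R M N \<longleftrightarrow> submodule N R M \<and>
    (\<forall>r\<in>carrier R. \<forall>m\<in>carrier M.
      r \<odot>\<^bsub>M\<^esub> m \<in> N \<longrightarrow> m \<in> N \<or> (\<forall>x\<in>carrier M. r \<odot>\<^bsub>M\<^esub> x \<in> N))"

definition semiprime_submodule ::
    "('a, 'c) ring_scheme \<Rightarrow> nat \<Rightarrow> (nat \<Rightarrow> 'a) set \<Rightarrow> bool" where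
  "semiprime_submodule R n N \<longleftrightarrow> submodule N R (free_module R n) \<and>
    (\<forall>f\<in>carrier (free_module R n).
      (\<forall>i\<in>{1..n}. f i \<odot>\<^bsub>free_module R n\<^esub> f \<in> N) \<longrightarrow> f \<in> N)"

text \<open>
  Prime submodules need not be proper, so for a module \<open>M\<close> and a submodule \<open>N\<close> the
  intersection below ranges over a family that contains \<open>carrier M\<close>; it is never the
  empty intersection \<open>UNIV\<close>.
\<close>

definition module_radical ::
    "('a, 'c) ring_scheme \<Rightarrow> ('a, 'b, 'd) module_scheme \<Rightarrow> 'b set \<Rightarrow> 'b set" where
  "module_radical R M N = \<Inter>{P. prime_submodule R M P \<and> N \<subseteq> P}"

definition radical_submodule ::
    "('a, 'c) ring_scheme \<Rightarrow> ('a, 'b, 'd) module_scheme \<Rightarrow> 'b set \<Rightarrow> bool" where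
  "radical_submodule R M N \<longleftrightarrow> submodule N R M \<and> module_radical R M N = N"

lemma free_module_is_module:
  assumes "cring R"
  shows "module R (free_module R n)"
proof -
  interpret R: cring R by fact
  have "abelian_group (free_module R n)"
  proof (rule abelian_groupI)
    fix f assume f: "f \<in> carrier (free_module R n)"
    show "\<exists>g\<in>carrier (free_module R n). g \<oplus>\<^bsub>free_module R n\<^esub> f = \<zero>\<^bsub>free_module R n\<^esub>"
      using f by (intro bexI[of _ "\<lambda>i\<in>{1..n}. \<ominus>\<^bsub>R\<^esub> f i"])
        (auto simp: free_module_def fun_eq_iff PiE_iff R.l_neg)
  qed (auto simp: free_module_def fun_eq_iff PiE_iff extensional_def R.a_ac)
  then show ?thesis
    by (intro moduleI assms)
      (auto simp: free_module_def fun_eq_iff PiE_iff extensional_def R.l_distr R.r_distr R.m_assoc)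
qed

lemma prime_submodule_carrier:
  assumes "module R M"
  shows "prime_submodule R M (carrier M)"
proof -
  interpret module R M by fact
  show ?thesis by (simp add: prime_submodule_def carrier_is_submodule)
qed

end

theory Submission
  imports Defs
begin

text \<open>
  The radical is an intersection of prime submodules, each of which is semiprime: if
  \<open>f\<^sub>i f\<close> lies in a prime submodule \<open>P\<close> for all \<open>i\<close> and \<open>f \<notin> P\<close>, then all \<open>f\<^sub>i R\<^sup>n\<close> lie in \<open>P\<close>, and
  so does \<open>f = \<Sum>\<^sub>i f\<^sub>i e\<^sub>i\<close>.  What remains is to separate a semiprime submodule \<open>K\<close> from a
  vector \<open>f \<notin> K\<close> by a prime submodule.

  The ideal \<open>I = (K : f)\<close> is proper, and it is a radical ideal: if \<open>a\<^sup>2 f \<in> K\<close>, then all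
  \<open>(a f)\<^sub>i (a f) = f\<^sub>i a\<^sup>2 f\<close> lie in \<open>K\<close>, whence \<open>a f \<in> K\<close>.  Let \<open>p\<close> be a minimal prime over
  \<open>I\<close>, and let \<open>S\<close> be its complement.  Since \<open>I\<close> is radical, the localization \<open>(R/I)\<^sub>p\<close> is a
  field; that is, every \<open>q \<in> p\<close> satisfies \<open>t q \<in> I\<close> for some \<open>t \<in> S\<close>.  The preimage in
  \<open>R\<^sup>n\<close> of the subspace spanned by \<open>K\<close> over this field is a prime submodule \<open>P\<close> that contains
  \<open>K\<close>.  It consists of the vectors \<open>m\<close> such that some \<open>g = s m + k\<close> with \<open>s \<in> S\<close> and \<open>k \<in> K\<close>
  has all its coordinates in \<open>I\<close>.

  If \<open>f\<close> belonged to \<open>P\<close>, there would be such a \<open>g = s f + k\<close>.  Then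
  \<open>g\<^sub>i g = s (g\<^sub>i f) + g\<^sub>i k\<close> is in \<open>K\<close> for all \<open>i\<close>, because \<open>g\<^sub>i f \<in> K\<close>.  As \<open>K\<close> is semiprime,
  \<open>g \<in> K\<close>; hence \<open>s f \<in> K\<close> and \<open>s \<in> S \<inter> I\<close>, a contradiction.

  The set \<open>S\<close> is obtained directly, as a maximal multiplicative set disjoint from \<open>I\<close>.
\<close>

section \<open>Maximal multiplicative sets\<close>

context cring
begin

text \<open>Induction on the exponent, rounding it up to an even number and halving it.\<close>

lemma mem_if_pow_mem:
  assumes absorb: "\<And>r a. r \<in> carrier R \<Longrightarrow> a \<in> I \<Longrightarrow> r \<otimes> a \<in> I"
    and sqrt: "\<And>a. a \<in> carrier R \<Longrightarrow> a \<otimes> a \<in> I \<Longrightarrow> a \<in> I"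
    and a: "a \<in> carrier R"
  shows "a [^] Suc k \<in> I \<Longrightarrow> a \<in> I"
proof (induction k rule: less_induct)
  case (less k)
  show ?case
  proof (cases k)
    case 0
    then show ?thesis using less.prems a by simp
  next
    case (Suc l)
    have "a [^] (Suc k + (if odd k then 0 else 1)) \<in> I"
      using less.prems a absorb[of a "a [^] Suc k"] by (auto simp: m_comm)
    moreover have "Suc k + (if odd k then 0 else 1) = Suc (k div 2) + Suc (k div 2)"
      by (cases "odd k") (auto elim!: oddE evenE)
    ultimately have "a [^] Suc (k div 2) \<otimes> a [^] Suc (k div 2) \<in> I"
      using nat_pow_mult[OF a] by metis
    then have "a [^] Suc (k div 2) \<in> I"
      using sqrt a nat_pow_closed by blast
    then show ?thesis
      using less.IH[of "k div 2"] Suc by simp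
  qed
qed

text \<open>
  For a radical ideal \<open>I\<close>, such an \<open>S\<close> is the complement of a minimal prime over \<open>I\<close>.  By maximality, an element
  \<open>q \<notin> S\<close> generates together with \<open>S\<close> a multiplicative set that meets \<open>I\<close>, say in \<open>s q\<^sup>k\<close>;
  since \<open>I\<close> is radical, already \<open>s q\<close> is in \<open>I\<close>.
\<close>

lemma exists_maximal_submonoid:
  assumes absorb: "\<And>r a. r \<in> carrier R \<Longrightarrow> a \<in> I \<Longrightarrow> r \<otimes> a \<in> I"
    and sqrt: "\<And>a. a \<in> carrier R \<Longrightarrow> a \<otimes> a \<in> I \<Longrightarrow> a \<in> I"
    and one: "\<one> \<notin> I"
  shows "\<exists>S. submonoid S R \<and> S \<inter> I = {} \<and> (\<forall>q\<in>carrier R - S. \<exists>t\<in>S. t \<otimes> q \<in> I)"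
proof -
  let ?A = "{S. submonoid S R \<and> S \<inter> I = {}}"
  have "\<exists>S\<in>?A. \<forall>X\<in>?A. S \<subseteq> X \<longrightarrow> X = S"
  proof (rule subset_Zorn_nonempty)
    have "{\<one>} \<in> ?A"
      using one by (auto intro!: submonoid.intro)
    then show "?A \<noteq> {}" by blast
  next
    fix C assume C: "C \<noteq> {}" "subset.chain ?A C"
    then have sub: "submonoid X R" "X \<inter> I = {}" if "X \<in> C" for X
      using that by (auto simp: subset_chain_def)
    have "submonoid (\<Union>C) R"
    proof (rule submonoid.intro)
      show "\<Union>C \<subseteq> carrier R" "\<one> \<in> \<Union>C"
        using sub(1) C(1) by (auto dest: submonoid.subset submonoid.one_closed)
    next
      fix x y assume "x \<in> \<Union>C" "y \<in> \<Union>C"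
      then obtain X where "X \<in> C" "x \<in> X" "y \<in> X"
        using C(2) by (auto simp: subset_chain_def) (metis subsetD)
      then show "x \<otimes> y \<in> \<Union>C"
        using submonoid.m_closed[OF sub(1)] by blast
    qed
    then show "\<Union>C \<in> ?A"
      using sub(2) by blast
  qed
  then obtain S where S: "submonoid S R" "S \<inter> I = {}"
    and max: "\<And>X. submonoid X R \<Longrightarrow> X \<inter> I = {} \<Longrightarrow> S \<subseteq> X \<Longrightarrow> X = S"
    by auto
  interpret S: submonoid S R by fact
  have "\<exists>t\<in>S. t \<otimes> q \<in> I" if q: "q \<in> carrier R" "q \<notin> S" for q
  proof -
    define T where "T = {x. \<exists>s\<in>S. \<exists>k :: nat. x = s \<otimes> q [^] k}"
    have TI: "s \<otimes> q [^] k \<in> T" if "s \<in> S" for s and k :: nat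
      using that unfolding T_def by blast
    have "submonoid T R"
    proof (rule submonoid.intro)
      show "T \<subseteq> carrier R" using q by (auto simp: T_def)
      show "\<one> \<in> T" using TI[of \<one> 0] by simp
    next
      fix x y assume "x \<in> T" "y \<in> T"
      then obtain s t k l where st: "s \<in> S" "t \<in> S"
        and xy: "x = s \<otimes> q [^] (k::nat)" "y = t \<otimes> q [^] (l::nat)"
        unfolding T_def by blast
      have "x \<otimes> y = (s \<otimes> t) \<otimes> q [^] (k + l)"
        using q st by (simp add: xy m_ac flip: nat_pow_mult)
      then show "x \<otimes> y \<in> T" using TI[of "s \<otimes> t" "k + l"] st by simp
    qed
    moreover have "S \<subseteq> T"
      using TI[of _ 0] by auto
    moreover have "q \<in> T"
      using TI[of \<one> 1] q by simp
    ultimately have "T \<inter> I \<noteq> {}"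
      using max q(2) by blast
    then obtain s k where s: "s \<in> S" and mem: "s \<otimes> q [^] (k::nat) \<in> I"
      unfolding T_def by blast
    have "(s [^] k \<otimes> q) \<otimes> (s \<otimes> q [^] k) \<in> I"
      using absorb[OF _ mem, of "s [^] k \<otimes> q"] s q by simp
    moreover have "(s [^] k \<otimes> q) \<otimes> (s \<otimes> q [^] k) = (s \<otimes> q) [^] Suc k"
      using s q by (simp add: nat_pow_distrib m_ac)
    ultimately have "s \<otimes> q \<in> I"
      using mem_if_pow_mem[OF absorb sqrt, where a = "s \<otimes> q" and k = k] s q by simp
    then show ?thesis using s by blast
  qed
  then show ?thesis using S by blast
qed

end

section \<open>Prime submodules are semiprime\<close>

locale coordinate_module = R?: cring R for R (structure) +
  fixes n :: nat and M :: "('a, nat \<Rightarrow> 'a) module" (structure)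
  assumes M_eq: "M = free_module R n"

sublocale coordinate_module \<subseteq> module R M
  using free_module_is_module[OF cring_axioms] by (simp add: M_eq)

context coordinate_module
begin

lemma coord_closed [simp]: "x \<in> carrier M \<Longrightarrow> i \<in> {1..n} \<Longrightarrow> x i \<in> carrier R"
  by (auto simp: M_eq free_module_def)

lemma coord_add [simp]: "i \<in> {1..n} \<Longrightarrow> (x \<oplus>\<^bsub>M\<^esub> y) i = x i \<oplus> y i"
  by (simp add: M_eq free_module_def)

lemma coord_smult [simp]: "i \<in> {1..n} \<Longrightarrow> (r \<odot>\<^bsub>M\<^esub> x) i = r \<otimes> x i"
  by (simp add: M_eq free_module_def)

lemma coord_zero [simp]: "i \<in> {1..n} \<Longrightarrow> \<zero>\<^bsub>M\<^esub> i = \<zero>"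
  by (simp add: M_eq free_module_def)

text \<open>The expansion \<open>f = \<Sum>\<^sub>i f\<^sub>i e\<^sub>i\<close>, by induction on the number of coordinates summed so far.\<close>

lemma mem_submodule_if_coords:
  assumes P: "submodule P R M" and f: "f \<in> carrier M"
    and coords: "\<And>i x. i \<in> {1..n} \<Longrightarrow> x \<in> carrier M \<Longrightarrow> f i \<odot>\<^bsub>M\<^esub> x \<in> P"
  shows "f \<in> P"
proof -
  define trunc where "trunc k = (\<lambda>i\<in>{1..n}. if i \<le> k then f i else \<zero>)" for k
  have "k \<le> n \<Longrightarrow> trunc k \<in> P" for k
  proof (induction k)
    case 0
    have "trunc 0 = \<zero>\<^bsub>M\<^esub>"
      by (auto simp: trunc_def M_eq free_module_def)
    then show ?case
      using subgroup.one_closed[OF submodule.axioms(1)[OF P]] by simp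
  next
    case (Suc k)
    define e where "e = (\<lambda>i\<in>{1..n}. if i = Suc k then \<one> else \<zero>)"
    have "e \<in> carrier M"
      by (auto simp: e_def M_eq free_module_def)
    then have "trunc k \<oplus>\<^bsub>M\<^esub> f (Suc k) \<odot>\<^bsub>M\<^esub> e \<in> P"
      using Suc coords submoduleE(5)[OF P] by simp
    moreover have "trunc k \<oplus>\<^bsub>M\<^esub> f (Suc k) \<odot>\<^bsub>M\<^esub> e = trunc (Suc k)"
    proof
      fix i show "(trunc k \<oplus>\<^bsub>M\<^esub> f (Suc k) \<odot>\<^bsub>M\<^esub> e) i = trunc (Suc k) i"
        using Suc.prems f coord_closed[OF f]
        by (cases "i \<in> {1..n}"; cases "i = Suc k")
          (auto simp: trunc_def e_def M_eq free_module_def)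
    qed
    ultimately show ?case by simp
  qed
  moreover have "trunc n = f"
    using f by (auto simp: trunc_def M_eq free_module_def PiE_iff extensional_def)
  ultimately show ?thesis by (metis le_refl)
qed

lemma prime_imp_semiprime:
  assumes "prime_submodule R M P"
  shows "semiprime_submodule R n P"
proof -
  have P: "submodule P R M"
    and prime: "\<And>r m x. r \<in> carrier R \<Longrightarrow> m \<in> carrier M \<Longrightarrow> r \<odot>\<^bsub>M\<^esub> m \<in> P \<Longrightarrow> m \<notin> P \<Longrightarrow>
      x \<in> carrier M \<Longrightarrow> r \<odot>\<^bsub>M\<^esub> x \<in> P"
    using assms by (auto simp: prime_submodule_def)
  have "f \<in> P" if f: "f \<in> carrier M" and sq: "\<And>i. i \<in> {1..n} \<Longrightarrow> f i \<odot>\<^bsub>M\<^esub> f \<in> P" for f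
  proof (rule ccontr)
    assume "f \<notin> P"
    then have "f i \<odot>\<^bsub>M\<^esub> x \<in> P" if "i \<in> {1..n}" "x \<in> carrier M" for i x
      using prime[OF coord_closed[OF f that(1)] f sq[OF that(1)] _ that(2)] by blast
    then show False
      using mem_submodule_if_coords[OF P f] \<open>f \<notin> P\<close> by blast
  qed
  then show ?thesis
    using P unfolding semiprime_submodule_def M_eq[symmetric] by blast
qed

lemma semiprime_radical:
  assumes N: "N \<subseteq> carrier M"
  shows "semiprime_submodule R n (module_radical R M N)"
proof -
  let ?F = "{P. prime_submodule R M P \<and> N \<subseteq> P}"
  have sub: "submodule P R M" if "P \<in> ?F" for P
    using that by (auto simp: prime_submodule_def)
  have semi: "f \<in> P"
    if "P \<in> ?F" "f \<in> carrier M" "\<forall>i\<in>{1..n}. f i \<odot>\<^bsub>M\<^esub> f \<in> P" for P f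
    using that prime_imp_semiprime[of P] by (simp add: semiprime_submodule_def M_eq)
  \<comment> \<open>The family is not empty, so its intersection consists of vectors.\<close>
  have "carrier M \<in> ?F"
    using N prime_submodule_carrier[OF module_axioms] by simp
  then have "submodule (\<Inter>?F) R M"
    using sub
    by (intro submoduleI)
      (blast intro: subgroup.one_closed[OF submodule.axioms(1), of _ R M, simplified]
        dest: submoduleE)+
  then show ?thesis
    using semi unfolding semiprime_submodule_def module_radical_def M_eq[symmetric] by blast
qed

section \<open>Separating a vector from a semiprime submodule\<close>

text \<open>
  If \<open>K\<close> is semiprime and \<open>S\<close> is the complement of a minimal prime \<open>p\<close> over \<open>(K : f)\<close>, this
  is the preimage of the span of \<open>K\<close> over the residue field of \<open>p\<close>.
\<close>

definition residual_span :: "'a set \<Rightarrow> (nat \<Rightarrow> 'a) set \<Rightarrow> (nat \<Rightarrow> 'a) \<Rightarrow> (nat \<Rightarrow> 'a) set" where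
  "residual_span S K f =
    {m \<in> carrier M. \<exists>s\<in>S. \<exists>k\<in>K. \<forall>i\<in>{1..n}. (s \<odot>\<^bsub>M\<^esub> m \<oplus>\<^bsub>M\<^esub> k) i \<odot>\<^bsub>M\<^esub> f \<in> K}"

lemma residual_spanI:
  "m \<in> carrier M \<Longrightarrow> s \<in> S \<Longrightarrow> k \<in> K \<Longrightarrow>
    (\<And>i. i \<in> {1..n} \<Longrightarrow> (s \<odot>\<^bsub>M\<^esub> m \<oplus>\<^bsub>M\<^esub> k) i \<odot>\<^bsub>M\<^esub> f \<in> K) \<Longrightarrow> m \<in> residual_span S K f"
  unfolding residual_span_def by blast

lemma subset_residual_span:
  assumes S: "submonoid S R" and K: "submodule K R M" and f: "f \<in> carrier M"
  shows "K \<subseteq> residual_span S K f"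
proof
  fix m assume m: "m \<in> K"
  then have mc: "m \<in> carrier M" using submoduleE(1)[OF K] by blast
  have "\<zero>\<^bsub>M\<^esub> \<in> K"
    using submoduleE(4)[OF K _ m, of \<zero>] mc by simp
  then show "m \<in> residual_span S K f"
    using m mc f submodule.smult_closed[OF K] submoduleE(3)[OF K m]
    by (intro residual_spanI[OF _ submonoid.one_closed[OF S], of _ "\<ominus>\<^bsub>M\<^esub> m"])
      (simp_all add: M.r_neg del: coord_add coord_smult)
qed

lemma submodule_residual_span:
  assumes S: "submonoid S R" and K: "submodule K R M" and f: "f \<in> carrier M"
  shows "submodule (residual_span S K f) R M"
proof -
  note Sc = subsetD[OF submonoid.subset[OF S]] and Kc = subsetD[OF submoduleE(1)[OF K]]
  have smult: "r \<odot>\<^bsub>M\<^esub> m \<in> residual_span S K f"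
    if r: "r \<in> carrier R" and "m \<in> residual_span S K f" for r m
  proof -
    from that obtain s k where m: "m \<in> carrier M" and s: "s \<in> S" and k: "k \<in> K"
      and *: "\<And>i. i \<in> {1..n} \<Longrightarrow> (s \<odot>\<^bsub>M\<^esub> m \<oplus>\<^bsub>M\<^esub> k) i \<odot>\<^bsub>M\<^esub> f \<in> K"
      by (auto simp: residual_span_def)
    show ?thesis
    proof (rule residual_spanI[OF _ s])
      show "r \<odot>\<^bsub>M\<^esub> m \<in> carrier M" "r \<odot>\<^bsub>M\<^esub> k \<in> K"
        using r m k submodule.smult_closed[OF K] by auto
      fix i assume i: "i \<in> {1..n}"
      have "(s \<odot>\<^bsub>M\<^esub> (r \<odot>\<^bsub>M\<^esub> m) \<oplus>\<^bsub>M\<^esub> r \<odot>\<^bsub>M\<^esub> k) i = r \<otimes> (s \<odot>\<^bsub>M\<^esub> m \<oplus>\<^bsub>M\<^esub> k) i"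
        using i r m Sc[OF s] Kc[OF k] by (simp add: r_distr m_lcomm)
      then show "(s \<odot>\<^bsub>M\<^esub> (r \<odot>\<^bsub>M\<^esub> m) \<oplus>\<^bsub>M\<^esub> r \<odot>\<^bsub>M\<^esub> k) i \<odot>\<^bsub>M\<^esub> f \<in> K"
        using submodule.smult_closed[OF K r *[OF i]] i r m f Sc[OF s] Kc[OF k]
        by (simp add: smult_assoc1)
    qed
  qed
  have add: "m \<oplus>\<^bsub>M\<^esub> m' \<in> residual_span S K f"
    if "m \<in> residual_span S K f" "m' \<in> residual_span S K f" for m m'
  proof -
    from that obtain s k s' k' where m: "m \<in> carrier M" "m' \<in> carrier M"
      and s: "s \<in> S" "s' \<in> S" and k: "k \<in> K" "k' \<in> K"
      and *: "\<And>i. i \<in> {1..n} \<Longrightarrow> (s \<odot>\<^bsub>M\<^esub> m \<oplus>\<^bsub>M\<^esub> k) i \<odot>\<^bsub>M\<^esub> f \<in> K"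
        "\<And>i. i \<in> {1..n} \<Longrightarrow> (s' \<odot>\<^bsub>M\<^esub> m' \<oplus>\<^bsub>M\<^esub> k') i \<odot>\<^bsub>M\<^esub> f \<in> K"
      by (auto simp: residual_span_def)
    note c = m Sc[OF s(1)] Sc[OF s(2)] Kc[OF k(1)] Kc[OF k(2)]
    let ?k = "s' \<odot>\<^bsub>M\<^esub> k \<oplus>\<^bsub>M\<^esub> s \<odot>\<^bsub>M\<^esub> k'"
    \<comment> \<open>Bring the two witnesses to the common denominator \<open>s s'\<close>.\<close>
    show ?thesis
    proof (rule residual_spanI)
      show "m \<oplus>\<^bsub>M\<^esub> m' \<in> carrier M" using m by simp
      show "s \<otimes> s' \<in> S" using s submonoid.m_closed[OF S] by blast
      show "?k \<in> K"
        using k c submoduleE(5)[OF K] submodule.smult_closed[OF K] by simp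
      fix i assume i: "i \<in> {1..n}"
      have "((s \<otimes> s') \<odot>\<^bsub>M\<^esub> (m \<oplus>\<^bsub>M\<^esub> m') \<oplus>\<^bsub>M\<^esub> ?k) i
          = s' \<otimes> (s \<odot>\<^bsub>M\<^esub> m \<oplus>\<^bsub>M\<^esub> k) i \<oplus> s \<otimes> (s' \<odot>\<^bsub>M\<^esub> m' \<oplus>\<^bsub>M\<^esub> k') i"
        using i c by (simp add: r_distr m_ac R.a_ac)
      moreover have "s' \<odot>\<^bsub>M\<^esub> ((s \<odot>\<^bsub>M\<^esub> m \<oplus>\<^bsub>M\<^esub> k) i \<odot>\<^bsub>M\<^esub> f)
          \<oplus>\<^bsub>M\<^esub> s \<odot>\<^bsub>M\<^esub> ((s' \<odot>\<^bsub>M\<^esub> m' \<oplus>\<^bsub>M\<^esub> k') i \<odot>\<^bsub>M\<^esub> f) \<in> K"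
        using *[OF i] c submoduleE(4,5)[OF K] by blast
      ultimately show "((s \<otimes> s') \<odot>\<^bsub>M\<^esub> (m \<oplus>\<^bsub>M\<^esub> m') \<oplus>\<^bsub>M\<^esub> ?k) i \<odot>\<^bsub>M\<^esub> f \<in> K"
        using i c f by (simp add: smult_l_distr smult_assoc1 del: coord_add coord_smult)
    qed
  qed
  show ?thesis
  proof (rule submoduleI)
    show sub: "residual_span S K f \<subseteq> carrier M"
      by (auto simp: residual_span_def)
    have "\<zero>\<^bsub>M\<^esub> \<in> K"
      using subgroup.one_closed[OF submodule.axioms(1)[OF K]] by simp
    then show "\<zero>\<^bsub>M\<^esub> \<in> residual_span S K f"
      using subset_residual_span[OF S K f] by blast
    show "\<ominus>\<^bsub>M\<^esub> m \<in> residual_span S K f" if "m \<in> residual_span S K f" for m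
      using smult[of "\<ominus> \<one>", OF _ that] that sub by (auto simp: smult_l_minus)
  qed (use smult add in auto)
qed

text \<open>
  A scalar in \<open>S\<close> is cancelled by enlarging the denominator; a scalar outside \<open>S\<close> vanishes
  in the residue field, so it maps all of \<open>R\<^sup>n\<close> into the span.
\<close>

lemma prime_residual_span:
  assumes S: "submonoid S R" and K: "submodule K R M" and f: "f \<in> carrier M"
    and kill: "\<And>q. q \<in> carrier R - S \<Longrightarrow> \<exists>t\<in>S. (t \<otimes> q) \<odot>\<^bsub>M\<^esub> f \<in> K"
  shows "prime_submodule R M (residual_span S K f)"
proof -
  note Sc = subsetD[OF submonoid.subset[OF S]] and Kc = subsetD[OF submoduleE(1)[OF K]]
  have "m \<in> residual_span S K f"
    if r: "r \<in> S" and m: "m \<in> carrier M" and rm: "r \<odot>\<^bsub>M\<^esub> m \<in> residual_span S K f" for r m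
  proof -
    obtain s k where s: "s \<in> S" and k: "k \<in> K"
      and "\<And>i. i \<in> {1..n} \<Longrightarrow> (s \<odot>\<^bsub>M\<^esub> (r \<odot>\<^bsub>M\<^esub> m) \<oplus>\<^bsub>M\<^esub> k) i \<odot>\<^bsub>M\<^esub> f \<in> K"
      using rm by (auto simp: residual_span_def)
    then show ?thesis
      using m Sc[OF r] Sc[OF s] submonoid.m_closed[OF S s r]
      by (intro residual_spanI[of m "s \<otimes> r" S k]) (simp_all add: smult_assoc1 m_assoc)
  qed
  moreover have "r \<odot>\<^bsub>M\<^esub> x \<in> residual_span S K f"
    if r: "r \<in> carrier R - S" and x: "x \<in> carrier M" for r x
  proof -
    obtain t where t: "t \<in> S" and tr: "(t \<otimes> r) \<odot>\<^bsub>M\<^esub> f \<in> K"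
      using kill[OF r] by blast
    show ?thesis
    proof (rule residual_spanI[OF _ t])
      show "r \<odot>\<^bsub>M\<^esub> x \<in> carrier M" using r x by simp
      show "\<zero>\<^bsub>M\<^esub> \<in> K"
        using subgroup.one_closed[OF submodule.axioms(1)[OF K]] by simp
      fix i assume i: "i \<in> {1..n}"
      have "(t \<odot>\<^bsub>M\<^esub> (r \<odot>\<^bsub>M\<^esub> x) \<oplus>\<^bsub>M\<^esub> \<zero>\<^bsub>M\<^esub>) i \<odot>\<^bsub>M\<^esub> f = x i \<odot>\<^bsub>M\<^esub> ((t \<otimes> r) \<odot>\<^bsub>M\<^esub> f)"
        using i r x f Sc[OF t] by (simp add: m_ac flip: smult_assoc1)
      then show "(t \<odot>\<^bsub>M\<^esub> (r \<odot>\<^bsub>M\<^esub> x) \<oplus>\<^bsub>M\<^esub> \<zero>\<^bsub>M\<^esub>) i \<odot>\<^bsub>M\<^esub> f \<in> K"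
        using submodule.smult_closed[OF K _ tr, of "x i"] i x by simp
    qed
  qed
  ultimately show ?thesis
    unfolding prime_submodule_def using submodule_residual_span[OF S K f] by blast
qed

text \<open>
  Here semiprimeness enters: if \<open>g = s f + k\<close> and every \<open>g\<^sub>i f\<close> is in \<open>K\<close>, then every
  \<open>g\<^sub>i g\<close> is in \<open>K\<close>, hence so are \<open>g\<close> and \<open>s f\<close>.
\<close>

lemma not_mem_residual_span:
  assumes S: "submonoid S R" and semi: "semiprime_submodule R n K" and f: "f \<in> carrier M"
    and avoid: "\<And>s. s \<in> S \<Longrightarrow> s \<odot>\<^bsub>M\<^esub> f \<notin> K"
  shows "f \<notin> residual_span S K f"
proof
  have K: "submodule K R M" and sqrt: "\<And>g. g \<in> carrier M \<Longrightarrow>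
      (\<And>i. i \<in> {1..n} \<Longrightarrow> g i \<odot>\<^bsub>M\<^esub> g \<in> K) \<Longrightarrow> g \<in> K"
    using semi by (auto simp: semiprime_submodule_def M_eq)
  note Sc = subsetD[OF submonoid.subset[OF S]] and Kc = subsetD[OF submoduleE(1)[OF K]]
  assume "f \<in> residual_span S K f"
  then obtain s k where s: "s \<in> S" and k: "k \<in> K"
    and *: "\<And>i. i \<in> {1..n} \<Longrightarrow> (s \<odot>\<^bsub>M\<^esub> f \<oplus>\<^bsub>M\<^esub> k) i \<odot>\<^bsub>M\<^esub> f \<in> K"
    by (auto simp: residual_span_def)
  define g where "g = s \<odot>\<^bsub>M\<^esub> f \<oplus>\<^bsub>M\<^esub> k"
  have g: "g \<in> carrier M"
    using f Sc[OF s] Kc[OF k] by (simp add: g_def)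
  have "g \<in> K"
  proof (rule sqrt[OF g])
    fix i assume i: "i \<in> {1..n}"
    note gi = coord_closed[OF g i]
    have "g i \<odot>\<^bsub>M\<^esub> g = g i \<odot>\<^bsub>M\<^esub> (s \<odot>\<^bsub>M\<^esub> f \<oplus>\<^bsub>M\<^esub> k)"
      by (simp only: g_def)
    also have "\<dots> = s \<odot>\<^bsub>M\<^esub> (g i \<odot>\<^bsub>M\<^esub> f) \<oplus>\<^bsub>M\<^esub> g i \<odot>\<^bsub>M\<^esub> k"
      using gi f Sc[OF s] Kc[OF k] by (simp add: smult_r_distr m_comm flip: smult_assoc1)
    also have "\<dots> \<in> K"
      using *[OF i] gi k Sc[OF s] submoduleE(4,5)[OF K] by (simp add: g_def)
    finally show "g i \<odot>\<^bsub>M\<^esub> g \<in> K" .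
  qed
  then have "g \<oplus>\<^bsub>M\<^esub> \<ominus>\<^bsub>M\<^esub> k \<in> K"
    using k submoduleE(3,5)[OF K] by blast
  moreover have "g \<oplus>\<^bsub>M\<^esub> \<ominus>\<^bsub>M\<^esub> k = s \<odot>\<^bsub>M\<^esub> f"
    using f Sc[OF s] Kc[OF k] by (simp add: g_def M.a_assoc M.r_neg)
  ultimately show False
    using avoid[OF s] by simp
qed

lemma separating_prime_submodule:
  assumes semi: "semiprime_submodule R n K" and f: "f \<in> carrier M" "f \<notin> K"
  shows "\<exists>P. prime_submodule R M P \<and> K \<subseteq> P \<and> f \<notin> P"
proof -
  have K: "submodule K R M" and sqrt: "\<And>g. g \<in> carrier M \<Longrightarrow>
      (\<And>i. i \<in> {1..n} \<Longrightarrow> g i \<odot>\<^bsub>M\<^esub> g \<in> K) \<Longrightarrow> g \<in> K"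
    using semi by (auto simp: semiprime_submodule_def M_eq)
  let ?I = "{a \<in> carrier R. a \<odot>\<^bsub>M\<^esub> f \<in> K}"
  have "\<exists>S. submonoid S R \<and> S \<inter> ?I = {} \<and> (\<forall>q\<in>carrier R - S. \<exists>t\<in>S. t \<otimes> q \<in> ?I)"
  proof (rule exists_maximal_submonoid)
    show "r \<otimes> a \<in> ?I" if "r \<in> carrier R" "a \<in> ?I" for r a
      using that f submodule.smult_closed[OF K] by (auto simp: smult_assoc1)
    show "\<one> \<notin> ?I" using f by simp
    fix a assume a: "a \<in> carrier R" "a \<otimes> a \<in> ?I"
    have "a \<odot>\<^bsub>M\<^esub> f \<in> K"
    proof (rule sqrt)
      show "a \<odot>\<^bsub>M\<^esub> f \<in> carrier M" using a f by simp
      fix i assume i: "i \<in> {1..n}"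
      have "(a \<odot>\<^bsub>M\<^esub> f) i \<odot>\<^bsub>M\<^esub> (a \<odot>\<^bsub>M\<^esub> f) = f i \<odot>\<^bsub>M\<^esub> ((a \<otimes> a) \<odot>\<^bsub>M\<^esub> f)"
        using a f i by (simp add: m_ac flip: smult_assoc1)
      then show "(a \<odot>\<^bsub>M\<^esub> f) i \<odot>\<^bsub>M\<^esub> (a \<odot>\<^bsub>M\<^esub> f) \<in> K"
        using a f i submodule.smult_closed[OF K] by simp
    qed
    then show "a \<in> ?I" using a by simp
  qed
  then obtain S where S: "submonoid S R" and "S \<inter> ?I = {}"
    and kill: "\<forall>q\<in>carrier R - S. \<exists>t\<in>S. t \<otimes> q \<in> ?I"
    by blast
  then have "s \<odot>\<^bsub>M\<^esub> f \<notin> K" if "s \<in> S" for s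
    using that submonoid.subset[OF S] by blast
  then have "f \<notin> residual_span S K f"
    by (rule not_mem_residual_span[OF S semi f(1)])
  moreover have "prime_submodule R M (residual_span S K f)"
    using kill by (intro prime_residual_span[OF S K f(1)]) blast
  ultimately show ?thesis
    using subset_residual_span[OF S K f(1)] by blast
qed

lemma radical_subset_semiprime:
  assumes semi: "semiprime_submodule R n K" and "N \<subseteq> K"
  shows "module_radical R M N \<subseteq> K"
proof -
  have "K \<subseteq> carrier M"
    using semi submoduleE(1) by (simp add: semiprime_submodule_def M_eq)
  then have "module_radical R M N \<subseteq> carrier M"
    using assms(2) prime_submodule_carrier[OF module_axioms] by (auto simp: module_radical_def)
  moreover have "f \<notin> module_radical R M N" if f: "f \<in> carrier M" "f \<notin> K" for f
    using separating_prime_submodule[OF semi f] assms(2)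
    unfolding module_radical_def by blast
  ultimately show ?thesis by blast
qed

end

theorem theorem1:
  fixes R :: "('a, 'c) ring_scheme" and n :: nat
  assumes "cring R" and "n \<ge> 1"
  shows "(\<forall>N. semiprime_submodule R n N \<longrightarrow> radical_submodule R (free_module R n) N) \<and>
    (\<forall>N. submodule N R (free_module R n) \<longrightarrow>
      semiprime_submodule R n (module_radical R (free_module R n) N) \<and>
      N \<subseteq> module_radical R (free_module R n) N \<and>
      (\<forall>K. semiprime_submodule R n K \<and> N \<subseteq> K \<longrightarrow> module_radical R (free_module R n) N \<subseteq> K))"
proof -
  interpret coordinate_module R n "free_module R n"
    by (intro coordinate_module.intro coordinate_module_axioms.intro assms refl)
  have incl: "N \<subseteq> module_radical R (free_module R n) N" for N
    by (auto simp: module_radical_def)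
  have "radical_submodule R (free_module R n) N" if "semiprime_submodule R n N" for N
    using that incl radical_subset_semiprime[OF that order_refl]
    by (simp add: radical_submodule_def semiprime_submodule_def equalityI)
  then show ?thesis
    using incl radical_subset_semiprime semiprime_radical[OF submoduleE(1)] by simp
qed

end
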